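(* Let $m,n$ be positive integers and let $A,B,C\in \mathbb{M}_m(\mathbb{M}_n)$ be positive semidefinite. Then \[ \mathrm{det}_1(A+B+C)+\mathrm{det}_1A+\mathrm{det}_1B+\mathrm{det}_1C\;\ge\;\mathrm{det}_1(A+B)+\mathrm{det}_1(A+C)+\mathrm{det}_1(B+C), \] and \[ \mathrm{det}_2(A+B+C)+\mathrm{det}_2A+\mathrm{det}_2B+\mathrm{det}_2C\;\ge\;\mathrm{det}_2(A+B)+\mathrm{det}_2(A+C)+\mathrm{det}_2(B+C). \]
   Context: $\mathbb{M}_k$ is the space of $k\times k$ complex matrices, and $\mathbb{M}_m(\mathbb{M}_n)$ is the set of $m\times m$ block matrices $A=[A_{ij}]_{i,j=1}^m$ with blocks $A_{ij}\in\mathbb{M}_n$ (positive semidefiniteness refers to $A$ viewed as an $mn\times mn$ complex Hermitian matrix). For Hermitian matrices $X,Y$ of the same size, $X\ge Y$ means that $X-Y$ is positive semidefinite. Partial determinants: let $A=[A_{ij}]_{i,j=1}^m\in\mathbb{M}_m(\mathbb{M}_n)$ with $A_{ij}=[a_{rs}^{ij}]_{r,s=1}^n$. Then $\mathrm{det}_2A=[\det A_{ij}]_{i,j=1}^m\in\mathbb{M}_m$. Putting $B_{rs}=[a_{rs}^{ij}]_{i,j=1}^m\in\mathbb{M}_m$ for $1\le r,s\le n$, $\mathrm{det}_1A=[\det B_{rs}]_{r,s=1}^n\in\mathbb{M}_n$. *)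

theory Defs
  imports "HOL-Analysis.Analysis"
begin

text \<open>
  The finite index types 'm and 'n play the roles of {1..m} and {1..n}: finite types are
  nonempty, so CARD('m) and CARD('n) range over all positive integers.
  The block A_ij of A is A $ i $ j, and its (r, s) entry is A $ i $ j $ r $ s.
\<close>

type_synonym ('n, 'm) block_matrix = "complex ^ 'n ^ 'n ^ 'm ^ 'm"

definition hermitian :: "complex ^ 'k ^ 'k \<Rightarrow> bool" where
  "hermitian X \<longleftrightarrow> map_matrix cnj (transpose X) = X"

text \<open>For Hermitian X the quadratic form is real, so nothing is lost by taking Re.\<close>

definition positive_semidefinite :: "complex ^ 'k ^ 'k \<Rightarrow> bool" where
  "positive_semidefinite X \<longleftrightarrow>
     hermitian X \<and> (\<forall>v. 0 \<le> Re (\<Sum>i\<in>UNIV. cnj (v $ i) * (X *v v) $ i))"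

definition loewner_ge :: "complex ^ 'k ^ 'k \<Rightarrow> complex ^ 'k ^ 'k \<Rightarrow> bool"
    (infix "\<succeq>\<^sub>L" 50) where
  "X \<succeq>\<^sub>L Y \<longleftrightarrow> hermitian X \<and> hermitian Y \<and> positive_semidefinite (X - Y)"

text \<open>
  A block matrix viewed as an mn x mn complex matrix: the row index (i, r) is row r of the
  i-th block row, the column index (j, s) is column s of the j-th block column.
\<close>

definition flatten_blocks :: "('n::finite, 'm::finite) block_matrix \<Rightarrow> complex ^ ('m \<times> 'n) ^ ('m \<times> 'n)" where
  "flatten_blocks A = (\<chi> p q. A $ fst p $ fst q $ snd p $ snd q)"

definition det\<^sub>1 :: "('n::finite, 'm::finite) block_matrix \<Rightarrow> complex ^ 'n ^ 'n" where
  "det\<^sub>1 A = (\<chi> r s. det (\<chi> i j. A $ i $ j $ r $ s))"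

definition det\<^sub>2 :: "('n::finite, 'm::finite) block_matrix \<Rightarrow> complex ^ 'm ^ 'm" where
  "det\<^sub>2 A = (\<chi> i j. det (A $ i $ j))"

end

theory Submission
  imports Defs
begin

text \<open>
  A positive semidefinite block matrix is a Gram matrix, so every entry of either partial
  determinant has the form \<open>det (X\<^sub>a X\<^sub>b\<^sup>*)\<close>. Cauchy--Binet turns it into a sum, over choices of
  columns, of products of minors; for a sum of block matrices the columns come from the disjoint
  union of the index sets of the summands. By inclusion--exclusion the claimed difference retains
  exactly the choices that meet all three index sets, hence is again a Gram matrix.
\<close>

section \<open>Quadratic forms and weighted Gram matrices\<close>

lemma positive_semidefinite_iff:
  "positive_semidefinite X \<longleftrightarrow> (\<forall>i j. cnj (X $ j $ i) = X $ i $ j) \<and>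
     (\<forall>v. 0 \<le> Re (\<Sum>i\<in>UNIV. \<Sum>j\<in>UNIV. cnj (v i) * X $ i $ j * v j))"
  (is "?L \<longleftrightarrow> ?H \<and> ?Q")
proof -
  have h: "hermitian X \<longleftrightarrow> ?H"
    by (auto simp: hermitian_def map_matrix_def transpose_def vec_eq_iff)
  have q: "(\<Sum>i\<in>UNIV. cnj (v $ i) * (X *v v) $ i)
      = (\<Sum>i\<in>UNIV. \<Sum>j\<in>UNIV. cnj (v $ i) * X $ i $ j * v $ j)" for v
    by (simp add: matrix_vector_mult_def sum_distrib_left mult.assoc)
  have "(\<forall>v. 0 \<le> Re (\<Sum>i\<in>UNIV. cnj (v $ i) * (X *v v) $ i)) \<longleftrightarrow> ?Q"
    unfolding q
  proof safe
    fix v assume "\<forall>v. 0 \<le> Re (\<Sum>i\<in>UNIV. \<Sum>j\<in>UNIV. cnj (v $ i) * X $ i $ j * v $ j)"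
    from this[rule_format, of "\<chi> i. v i"]
    show "0 \<le> Re (\<Sum>i\<in>UNIV. \<Sum>j\<in>UNIV. cnj (v i) * X $ i $ j * v j)" by simp
  qed blast
  with h show ?thesis by (simp add: positive_semidefinite_def)
qed

lemma quadratic_form_rank_one:
  fixes u v :: "'k::finite \<Rightarrow> complex"
  shows "(\<Sum>i\<in>UNIV. \<Sum>j\<in>UNIV. cnj (v i) * (u i * cnj (u j)) * v j)
    = of_real ((cmod (\<Sum>i\<in>UNIV. cnj (v i) * u i))\<^sup>2)"
proof -
  have "(\<Sum>i\<in>UNIV. \<Sum>j\<in>UNIV. cnj (v i) * (u i * cnj (u j)) * v j)
     = (\<Sum>i\<in>UNIV. cnj (v i) * u i) * cnj (\<Sum>i\<in>UNIV. cnj (v i) * u i)"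
    by (simp add: sum_product cnj_sum mult_ac)
  then show ?thesis by (simp only: complex_norm_square)
qed

text \<open>The quadratic form at \<open>v\<close> splits into squared moduli of pairings of
  \<open>v\<close> with \<open>D f\<close>, each weighted by \<open>c f\<close>.\<close>

lemma positive_semidefinite_weighted_gram:
  fixes X :: "complex ^ 'k::finite ^ 'k"
  assumes "\<And>f. f \<in> F \<Longrightarrow> 0 \<le> c f"
    and "\<And>a b. X $ a $ b = (\<Sum>f\<in>F. of_real (c f) * (D f a * cnj (D f b)))"
  shows "positive_semidefinite X"
  unfolding positive_semidefinite_iff
proof safe
  fix i j show "cnj (X $ j $ i) = X $ i $ j"
    by (simp add: assms(2) cnj_sum mult_ac)
next
  fix v :: "'k \<Rightarrow> complex"
  have "(\<Sum>i\<in>UNIV. \<Sum>j\<in>UNIV. cnj (v i) * X $ i $ j * v j)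
     = (\<Sum>i\<in>UNIV. \<Sum>j\<in>UNIV. \<Sum>f\<in>F. of_real (c f) * (cnj (v i) * (D f i * cnj (D f j)) * v j))"
    by (simp add: assms(2) sum_distrib_left sum_distrib_right mult_ac)
  also have "\<dots> = (\<Sum>i\<in>UNIV. \<Sum>f\<in>F. \<Sum>j\<in>UNIV. of_real (c f) * (cnj (v i) * (D f i * cnj (D f j)) * v j))"
    by (intro sum.cong refl sum.swap)
  also have "\<dots> = (\<Sum>f\<in>F. \<Sum>i\<in>UNIV. \<Sum>j\<in>UNIV. of_real (c f) * (cnj (v i) * (D f i * cnj (D f j)) * v j))"
    by (rule sum.swap)
  also have "\<dots> = (\<Sum>f\<in>F. of_real (c f * (cmod (\<Sum>i\<in>UNIV. cnj (v i) * D f i))\<^sup>2))"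
    by (simp only: sum_distrib_left[symmetric] quadratic_form_rank_one of_real_mult)
  finally have *: "(\<Sum>i\<in>UNIV. \<Sum>j\<in>UNIV. cnj (v i) * X $ i $ j * v j)
    = of_real (\<Sum>f\<in>F. c f * (cmod (\<Sum>i\<in>UNIV. cnj (v i) * D f i))\<^sup>2)" by simp
  show "0 \<le> Re (\<Sum>i\<in>UNIV. \<Sum>j\<in>UNIV. cnj (v i) * X $ i $ j * v j)"
    unfolding * Re_complex_of_real using assms(1) by (intro sum_nonneg) simp
qed

section \<open>Gram factorisation of a positive semidefinite matrix\<close>

lemma quadratic_form_perturb:
  fixes X :: "complex ^ 'k::finite ^ 'k" and v :: "'k \<Rightarrow> complex" and t :: complex and p :: 'k
  defines "u \<equiv> \<lambda>i. v i + (if i = p then t else 0)"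
  shows "(\<Sum>i\<in>UNIV. \<Sum>j\<in>UNIV. cnj (u i) * X $ i $ j * u j)
    = (\<Sum>i\<in>UNIV. \<Sum>j\<in>UNIV. cnj (v i) * X $ i $ j * v j)
      + (\<Sum>i\<in>UNIV. cnj (v i) * X $ i $ p) * t
      + cnj t * (\<Sum>j\<in>UNIV. X $ p $ j * v j) + cnj t * X $ p $ p * t"
proof -
  have "cnj (u i) * X $ i $ j * u j = cnj (v i) * X $ i $ j * v j
      + (if j = p then cnj (v i) * X $ i $ p * t else 0)
      + (if i = p then cnj t * (X $ p $ j * v j) else 0)
      + (if i = p then (if j = p then cnj t * X $ p $ p * t else 0) else 0)" for i j
    by (auto simp: u_def algebra_simps)
  \<comment> \<open>The condition on \<open>i\<close> has to leave the inner sum before the outer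
    sum can collapse to \<open>i = p\<close>.\<close>
  moreover have "(\<Sum>j\<in>UNIV. if i = p then h j else 0) = (if i = p then \<Sum>j\<in>UNIV. h j else 0)"
    for i and h :: "'k \<Rightarrow> complex" by simp
  ultimately show ?thesis
    by (simp add: sum.distrib sum_distrib_left sum_distrib_right)
qed

text \<open>Hermitian symmetry makes the two linear terms in \<open>t\<close> conjugate to each
  other. The signs of diagonal entries, the vanishing of columns and the Schur complement all follow
  by choosing \<open>v\<close> and \<open>t\<close>.\<close>

lemma positive_semidefinite_perturb:
  fixes X :: "complex ^ 'k::finite ^ 'k" and v :: "'k \<Rightarrow> complex" and t :: complex and p :: 'k
  defines "L \<equiv> (\<Sum>i\<in>UNIV. cnj (v i) * X $ i $ p)"
  assumes X: "positive_semidefinite X"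
  shows "0 \<le> Re ((\<Sum>i\<in>UNIV. \<Sum>j\<in>UNIV. cnj (v i) * X $ i $ j * v j)
    + L * t + cnj t * cnj L + cnj t * X $ p $ p * t)"
proof -
  have "(\<Sum>j\<in>UNIV. X $ p $ j * v j) = cnj L"
    using X by (simp add: L_def positive_semidefinite_iff cnj_sum mult.commute)
  moreover define u where "u = (\<lambda>i. v i + (if i = p then t else 0))"
  have "0 \<le> Re (\<Sum>i\<in>UNIV. \<Sum>j\<in>UNIV. cnj (u i) * X $ i $ j * u j)"
    using X unfolding positive_semidefinite_iff by blast
  ultimately show ?thesis
    unfolding u_def quadratic_form_perturb L_def[symmetric] by (simp only:)
qed

lemma positive_semidefinite_diagonal:
  fixes X :: "complex ^ 'k::finite ^ 'k"
  assumes "positive_semidefinite X"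
  obtains d where "0 \<le> d" "X $ p $ p = of_real d"
proof
  have "cnj (X $ p $ p) = X $ p $ p"
    using assms by (simp add: positive_semidefinite_iff)
  then show "X $ p $ p = of_real (Re (X $ p $ p))"
    by (simp add: complex_eq_iff)
  show "0 \<le> Re (X $ p $ p)"
    using positive_semidefinite_perturb[OF assms, of "\<lambda>_. 0" p 1] by simp
qed

text \<open>Without the diagonal entry the form is affine in \<open>t\<close>, hence unbounded below
  unless \<open>L = 0\<close>. For \<open>v\<close> the unit vector at \<open>q\<close>,
  \<open>L\<close> is the entry \<open>X $ q $ p\<close>.\<close>

lemma positive_semidefinite_zero_diagonal:
  fixes X :: "complex ^ 'k::finite ^ 'k"
  assumes X: "positive_semidefinite X" and p: "X $ p $ p = 0"
  shows "X $ q $ p = 0"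
proof (rule ccontr)
  assume nz: "X $ q $ p \<noteq> 0"
  define v :: "'k \<Rightarrow> complex" where "v = (\<lambda>i. if i = q then 1 else 0)"
  define L where "L = (\<Sum>i\<in>UNIV. cnj (v i) * X $ i $ p)"
  define q0 where "q0 = Re (\<Sum>i\<in>UNIV. \<Sum>j\<in>UNIV. cnj (v i) * X $ i $ j * v j)"
  have "L = (\<Sum>i\<in>UNIV. if i = q then X $ q $ p else 0)"
    unfolding L_def v_def by (intro sum.cong) auto
  then have L: "L \<noteq> 0" using nz by simp
  \<comment> \<open>Chosen so that \<open>L * t = - (q0 + 1)\<close>: the form drops to
    \<open>- q0 - 2\<close>, although \<open>q0\<close> is nonnegative.\<close>
  define s where "s = - (q0 + 1) / (cmod L)\<^sup>2"
  define t where "t = of_real s * cnj L"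
  have "0 \<le> Re ((\<Sum>i\<in>UNIV. \<Sum>j\<in>UNIV. cnj (v i) * X $ i $ j * v j) + L * t
      + cnj t * cnj L + cnj t * X $ p $ p * t)"
    unfolding L_def by (rule positive_semidefinite_perturb[OF X])
  moreover have "L * t = of_real (s * (cmod L)\<^sup>2)"
    unfolding t_def of_real_mult complex_norm_square by (simp add: mult_ac)
  then have Lt: "L * t = of_real (- (q0 + 1))" using L by (simp add: s_def)
  moreover have "cnj t * cnj L = of_real (- (q0 + 1))"
    using arg_cong[OF Lt, of cnj] by (simp add: mult.commute)
  ultimately have "0 \<le> q0 - 2 * (q0 + 1)" using p by (simp add: q0_def)
  moreover have "0 \<le> q0" using X by (simp add: positive_semidefinite_iff q0_def)
  ultimately show False by simp
qed

lemma positive_semidefinite_schur_step: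
  fixes X :: "complex ^ 'k::finite ^ 'k"
  assumes X: "positive_semidefinite X" and d: "0 < d" "X $ p $ p = of_real d"
  shows "positive_semidefinite (\<chi> i j. X $ i $ j - X $ i $ p * cnj (X $ j $ p) / of_real d)"
  unfolding positive_semidefinite_iff
proof safe
  have h: "cnj (X $ j $ i) = X $ i $ j" for i j
    using X by (simp add: positive_semidefinite_iff)
  fix i j
  show "cnj ((\<chi> i j. X $ i $ j - X $ i $ p * cnj (X $ j $ p) / of_real d) $ j $ i)
      = (\<chi> i j. X $ i $ j - X $ i $ p * cnj (X $ j $ p) / of_real d) $ i $ j"
    by (simp add: h)
next
  fix v :: "'k \<Rightarrow> complex"
  define Q where "Q = (\<Sum>i\<in>UNIV. \<Sum>j\<in>UNIV. cnj (v i) * X $ i $ j * v j)"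
  define L where "L = (\<Sum>i\<in>UNIV. cnj (v i) * X $ i $ p)"
  \<comment> \<open>The minimiser found by completing the square; the minimum is the form of the
    Schur complement at \<open>v\<close>.\<close>
  define t where "t = - cnj L / of_real d"
  have "0 \<le> Re (Q + L * t + cnj t * cnj L + cnj t * X $ p $ p * t)"
    unfolding L_def Q_def by (rule positive_semidefinite_perturb[OF X])
  also have "Q + L * t + cnj t * cnj L + cnj t * X $ p $ p * t = Q - L * cnj L / of_real d"
    using d by (simp add: t_def field_simps)
  also have "L * cnj L = (\<Sum>i\<in>UNIV. \<Sum>j\<in>UNIV. cnj (v i) * (X $ i $ p * cnj (X $ j $ p)) * v j)"
    using quadratic_form_rank_one[of v "\<lambda>i. X $ i $ p"]
    by (simp only: L_def complex_norm_square)
  also have "Q - \<dots> / of_real d = (\<Sum>i\<in>UNIV. \<Sum>j\<in>UNIV. cnj (v i) *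
      (\<chi> i j. X $ i $ j - X $ i $ p * cnj (X $ j $ p) / of_real d) $ i $ j * v j)"
    by (simp add: Q_def sum_divide_distrib sum_subtractf[symmetric] algebra_simps)
  finally show "0 \<le> Re (\<Sum>i\<in>UNIV. \<Sum>j\<in>UNIV. cnj (v i) *
      (\<chi> i j. X $ i $ j - X $ i $ p * cnj (X $ j $ p) / of_real d) $ i $ j * v j)" .
qed

text \<open>Cholesky elimination: each pivot \<open>p\<close> splits off a rank-one matrix that
  clears row \<open>p\<close>, leaving a positive semidefinite matrix whose nonzero rows lie in the
  smaller set. The support \<open>P\<close> is a parameter to make this induction possible.\<close>

lemma positive_semidefinite_gram_on:
  fixes X :: "complex ^ 'k::finite ^ 'k"
  assumes "finite P" "positive_semidefinite X" "\<And>i j. i \<notin> P \<Longrightarrow> X $ i $ j = 0"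
  shows "\<exists>w. \<forall>i j. X $ i $ j = (\<Sum>p\<in>P. w p i * cnj (w p j))"
  using assms
proof (induction P arbitrary: X rule: finite_induct)
  case empty
  then show ?case by simp
next
  case (insert p P)
  note X = insert.prems(1)
  have h: "cnj (X $ j $ i) = X $ i $ j" for i j
    using X by (simp add: positive_semidefinite_iff)
  obtain d where d: "0 \<le> d" "X $ p $ p = of_real d"
    using positive_semidefinite_diagonal[OF X] .
  \<comment> \<open>The scaled pivot column. For \<open>d = 0\<close>, division by zero gives
    \<open>u = 0\<close> and \<open>Y = X\<close>; row \<open>p\<close> of \<open>X\<close> is then
    already zero.\<close>
  define u where "u = (\<lambda>i. X $ i $ p / of_real (sqrt d))"
  define Y where "Y = (\<chi> i j. X $ i $ j - u i * cnj (u j))"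
  have uu: "u i * cnj (u j) = X $ i $ p * cnj (X $ j $ p) / of_real d" for i j
    using d(1) by (simp add: u_def flip: of_real_mult)
  have Y: "positive_semidefinite Y \<and> (\<forall>j. Y $ p $ j = 0)"
  proof (cases "d = 0")
    case True
    then have "X $ q $ p = 0" for q
      using positive_semidefinite_zero_diagonal[OF X] d by simp
    then show ?thesis
      using X h[of _ p] by (auto simp: Y_def u_def vec_lambda_eta)
  next
    case False
    with d have "0 < d" by simp
    with d show ?thesis
      using positive_semidefinite_schur_step[OF X \<open>0 < d\<close> d(2)] by (simp add: Y_def uu h)
  qed
  have "Y $ i $ j = 0" if "i \<notin> P" for i j
  proof (cases "i = p")
    case True
    with Y show ?thesis by blast
  next
    case False
    with that have "X $ i $ k = 0" for k
      by (intro insert.prems(2)) simp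
    then show ?thesis by (simp add: Y_def u_def)
  qed
  with insert.IH[of Y] Y obtain w where
    w: "\<And>i j. Y $ i $ j = (\<Sum>p\<in>P. w p i * cnj (w p j))" by blast
  have "X $ i $ j = (\<Sum>q\<in>insert p P. (w(p := u)) q i * cnj ((w(p := u)) q j))" for i j
  proof -
    have "X $ i $ j = u i * cnj (u j) + Y $ i $ j" by (simp add: Y_def)
    also have "Y $ i $ j = (\<Sum>q\<in>P. (w(p := u)) q i * cnj ((w(p := u)) q j))"
      unfolding w using insert.hyps by (intro sum.cong) auto
    finally show ?thesis using insert.hyps by simp
  qed
  then show ?case by blast
qed

lemma positive_semidefinite_gram:
  fixes X :: "complex ^ 'k::finite ^ 'k"
  assumes "positive_semidefinite X"
  obtains w :: "'k \<Rightarrow> 'k \<Rightarrow> complex"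
    where "\<And>i j. X $ i $ j = (\<Sum>p\<in>UNIV. w p i * cnj (w p j))"
  using positive_semidefinite_gram_on[of UNIV X] assms by auto

section \<open>The Cauchy-Binet formula and determinants of Gram matrices\<close>

text \<open>
  Summing over all maps \<open>f\<close> rather than over increasing ones counts
  every minor \<open>fact CARD('n)\<close> times.
\<close>

lemma cauchy_binet_functions:
  fixes x y :: "'t \<Rightarrow> 'n::finite \<Rightarrow> 'a::comm_ring_1"
  assumes K: "finite K"
  shows "of_nat (fact CARD('n)) * det (\<chi> r s. \<Sum>k\<in>K. x k r * y k s)
    = (\<Sum>f\<in>UNIV \<rightarrow>\<^sub>E K. det (\<chi> r s. x (f s) r) * det (\<chi> r s. y (f s) r))"
proof -
  define d where "d f = det (\<chi> r s. y (f r) s)" for f :: "'n \<Rightarrow> 't"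
  have "det (\<chi> r s. \<Sum>k\<in>K. x k r * y k s)
    = (\<Sum>p | p permutes UNIV. of_int (sign p) * (\<Sum>f\<in>UNIV \<rightarrow>\<^sub>E K. \<Prod>r\<in>UNIV. x (f r) r * y (f r) (p r)))"
    unfolding det_def by (simp add: prod_sum_PiE K)
  also have "\<dots> = (\<Sum>p | p permutes UNIV. \<Sum>f\<in>UNIV \<rightarrow>\<^sub>E K.
      (\<Prod>r\<in>UNIV. x (f r) r) * (of_int (sign p) * (\<Prod>r\<in>UNIV. y (f r) (p r))))"
    by (simp add: sum_distrib_left prod.distrib mult_ac)
  also have "\<dots> = (\<Sum>f\<in>UNIV \<rightarrow>\<^sub>E K. (\<Prod>r\<in>UNIV. x (f r) r) * d f)"
    by (subst sum.swap) (simp add: d_def det_def sum_distrib_left)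
  finally have expand: "det (\<chi> r s. \<Sum>k\<in>K. x k r * y k s)
    = (\<Sum>f\<in>UNIV \<rightarrow>\<^sub>E K. (\<Prod>r\<in>UNIV. x (f r) r) * d f)" .
  \<comment> \<open>Replacing \<open>f\<close> by \<open>f \<circ> p\<close> permutes the rows
    behind \<open>d f\<close>, which produces the sign of \<open>p\<close>.\<close>
  have reindex: "(\<Sum>f\<in>UNIV \<rightarrow>\<^sub>E K. (\<Prod>r\<in>UNIV. x (f r) r) * d f)
    = (\<Sum>f\<in>UNIV \<rightarrow>\<^sub>E K. of_int (sign p) * (\<Prod>r\<in>UNIV. x (f (p r)) r) * d f)"
    if p: "p permutes UNIV" for p :: "'n \<Rightarrow> 'n"
  proof -
    have "(\<Sum>f\<in>UNIV \<rightarrow>\<^sub>E K. (\<Prod>r\<in>UNIV. x (f r) r) * d f)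
      = (\<Sum>f\<in>UNIV \<rightarrow>\<^sub>E K. (\<Prod>r\<in>UNIV. x (f (p r)) r) * d (f \<circ> p))"
      by (rule sum.reindex_bij_witness[where i = "\<lambda>f. f \<circ> p" and j = "\<lambda>f. f \<circ> inv p"])
         (auto simp: PiE_UNIV_domain permutes_inverses[OF p] comp_def)
    moreover have "d (f \<circ> p) = of_int (sign p) * d f" for f
      using det_permute_rows[OF p, of "\<chi> r s. y (f r) s"] by (simp add: d_def)
    ultimately show ?thesis by (simp add: mult_ac)
  qed
  \<comment> \<open>One copy of the expansion is taken for each permutation \<open>p\<close> and
    reindexed by that \<open>p\<close>; summing over \<open>p\<close> then assembles the determinant
    in \<open>x\<close>.\<close>
  have "of_nat (fact CARD('n)) * det (\<chi> r s. \<Sum>k\<in>K. x k r * y k s)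
    = (\<Sum>p | p permutes (UNIV :: 'n set). \<Sum>f\<in>UNIV \<rightarrow>\<^sub>E K. (\<Prod>r\<in>UNIV. x (f r) r) * d f)"
    unfolding expand by (simp add: card_permutations)
  also have "\<dots> = (\<Sum>p | p permutes (UNIV :: 'n set). \<Sum>f\<in>UNIV \<rightarrow>\<^sub>E K.
      of_int (sign p) * (\<Prod>r\<in>UNIV. x (f (p r)) r) * d f)"
    by (intro sum.cong refl reindex) simp
  also have "\<dots> = (\<Sum>f\<in>UNIV \<rightarrow>\<^sub>E K. det (\<chi> r s. x (f s) r) * d f)"
    by (subst sum.swap) (simp add: det_def sum_distrib_right)
  also have "d = (\<lambda>f. det (\<chi> r s. y (f s) r))"
    unfolding d_def by (subst det_transpose[symmetric]) (simp add: transpose_def)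
  finally show ?thesis .
qed

text \<open>Conjugation commutes with \<open>det\<close>, so Cauchy-Binet writes the entry as a Gram
  sum with positive weights, indexed by \<open>f\<close>.\<close>

lemma det_gram:
  fixes w :: "'t \<Rightarrow> 'a \<Rightarrow> 'd::finite \<Rightarrow> complex"
  assumes "finite K"
  shows "det (\<chi> r s. \<Sum>k\<in>K. w k a r * cnj (w k b s))
    = (\<Sum>f\<in>UNIV \<rightarrow>\<^sub>E K. of_real (1 / fact CARD('d)) *
         (det (\<chi> r s. w (f s) a r) * cnj (det (\<chi> r s. w (f s) b r))))"
proof -
  have "cnj (det (\<chi> r s. w (f s) b r)) = det (\<chi> r s. cnj (w (f s) b r))" for f :: "'d \<Rightarrow> 't"
    by (simp add: det_def cnj_sum cnj_prod)
  then show ?thesis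
    using cauchy_binet_functions[OF assms, of "\<lambda>k. w k a" "\<lambda>k s. cnj (w k b s)"]
    by (simp add: field_simps flip: sum_divide_distrib)
qed

section \<open>The inequality for three Gram families\<close>

text \<open>A common form of both partial determinants: \<open>'a\<close> indexes the result and
  \<open>'d\<close> is the index over which determinants are taken.\<close>

definition det_block :: "('a::finite \<Rightarrow> 'a \<Rightarrow> 'd::finite \<Rightarrow> 'd \<Rightarrow> complex) \<Rightarrow> complex ^ 'a ^ 'a" where
  "det_block M = (\<chi> a b. det (\<chi> r s. M a b r s))"

lemma positive_semidefinite_det_block:
  fixes w :: "'t \<Rightarrow> 'a::finite \<Rightarrow> 'd::finite \<Rightarrow> complex"
  assumes "finite K"
  shows "positive_semidefinite (det_block (\<lambda>a b r s. \<Sum>k\<in>K. w k a r * cnj (w k b s)))"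
  by (rule positive_semidefinite_weighted_gram[where c = "\<lambda>_. 1 / fact CARD('d)"
        and F = "UNIV \<rightarrow>\<^sub>E K" and D = "\<lambda>f a. det (\<chi> r s. w (f s) a r)"])
     (simp_all add: det_block_def det_gram[OF assms])

lemma hermitian_add: "hermitian X \<Longrightarrow> hermitian Y \<Longrightarrow> hermitian (X + Y)"
  by (simp add: hermitian_def map_matrix_def transpose_def vec_eq_iff)

text \<open>The set \<open>J\<close> selects which of the three Gram matrices are added, so all
  seven terms are values of one function \<open>H\<close>.\<close>

lemma det_block_hlawka:
  fixes w :: "nat \<Rightarrow> 't::finite \<Rightarrow> 'a::finite \<Rightarrow> 'd::finite \<Rightarrow> complex"
  defines "H \<equiv> \<lambda>J. det_block (\<lambda>a b r s. \<Sum>c\<in>J. \<Sum>k\<in>UNIV. w c k a r * cnj (w c k b s))"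
  shows "H {0, 1, 2} + H {0} + H {1} + H {2} \<succeq>\<^sub>L H {0, 1} + H {0, 2} + H {1, 2}"
proof -
  \<comment> \<open>A sum of Gram matrices is a single Gram matrix over labelled indices
    \<open>(c, k)\<close>.\<close>
  define W where "W = (\<lambda>(c, k). w c k)"
  have H_eq: "H J = det_block (\<lambda>a b r s. \<Sum>k\<in>J \<times> UNIV. W k a r * cnj (W k b s))" for J
    by (simp add: H_def W_def sum.cartesian_product case_prod_beta)
  have herm: "hermitian (H J)" if "finite J" for J
    unfolding H_eq using positive_semidefinite_det_block[of "J \<times> UNIV" W] that
    by (simp add: positive_semidefinite_def)
  define F where "F = (UNIV :: 'd set) \<rightarrow>\<^sub>E ({0, 1, 2 :: nat} \<times> (UNIV :: 't set))"
  define D where "D f a = det (\<chi> r s. W (f s) a r)" for f a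
  \<comment> \<open>Tests whether \<open>f\<close> picks only indices with labels in
    \<open>J\<close>. All seven terms thus become sums over the same \<open>F\<close>, differing
    only in their weights.\<close>
  define e :: "nat set \<Rightarrow> ('d \<Rightarrow> nat \<times> 't) \<Rightarrow> real"
    where "e J f = of_bool (fst ` range f \<subseteq> J)" for J f
  have entry: "H J $ a $ b = (\<Sum>f\<in>F. of_real (e J f / fact CARD('d)) * (D f a * cnj (D f b)))"
    if J: "J \<subseteq> {0, 1, 2}" for J a b
  proof -
    have finJ: "finite J" using J by (rule finite_subset) simp
    have "H J $ a $ b = (\<Sum>f\<in>UNIV \<rightarrow>\<^sub>E (J \<times> UNIV). of_real (1 / fact CARD('d)) * (D f a * cnj (D f b)))"
      using det_gram[of "J \<times> UNIV" W a b] finJ by (simp add: H_eq det_block_def D_def)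
    also have "\<dots> = (\<Sum>f\<in>F. of_real (e J f / fact CARD('d)) * (D f a * cnj (D f b)))"
    proof (rule sum.mono_neutral_cong_left)
      show "finite F" unfolding F_def by (intro finite_PiE) auto
      show "(UNIV :: 'd set) \<rightarrow>\<^sub>E (J \<times> (UNIV :: 't set)) \<subseteq> F"
        unfolding F_def by (rule PiE_mono) (use J in auto)
    qed (auto simp: e_def PiE_UNIV_domain mem_Times_iff image_subset_iff Pi_iff)
    finally show ?thesis .
  qed
  \<comment> \<open>For \<open>f\<close> in \<open>F\<close> this is 1 if all three labels occur in
    \<open>f\<close>, and 0 otherwise.\<close>
  define c where "c f = e {0, 1, 2} f + e {0} f + e {1} f + e {2} f
    - e {0, 1} f - e {0, 2} f - e {1, 2} f" for f
  have c: "0 \<le> c f" for f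
  proof -
    define R where "R = fst ` range f"
    have "R \<noteq> {}" by (simp add: R_def)
    moreover have "{0, 1} \<inter> {0, 2} \<inter> {1, 2 :: nat} = {}" by auto
    ultimately have not_all: "\<not> (R \<subseteq> {0, 1} \<and> R \<subseteq> {0, 2} \<and> R \<subseteq> {1, 2})"
      by blast
    \<comment> \<open>Each singleton is the intersection of two pairs, so every weight depends only
      on the truth values of containment in the three pairs and in the whole set. A finite case
      check remains.\<close>
    have single: "R \<subseteq> {0} \<longleftrightarrow> R \<subseteq> {0, 1} \<and> R \<subseteq> {0, 2}"
      "R \<subseteq> {1} \<longleftrightarrow> R \<subseteq> {0, 1} \<and> R \<subseteq> {1, 2}" "R \<subseteq> {2} \<longleftrightarrow> R \<subseteq> {0, 2} \<and> R \<subseteq> {1, 2}"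
      by auto
    have pair: "R \<subseteq> {0, 1} \<Longrightarrow> R \<subseteq> {0, 1, 2}" "R \<subseteq> {0, 2} \<Longrightarrow> R \<subseteq> {0, 1, 2}"
      "R \<subseteq> {1, 2} \<Longrightarrow> R \<subseteq> {0, 1, 2}"
      by auto
    have "0 \<le> of_bool t + of_bool (p \<and> q) + of_bool (p \<and> r) + of_bool (q \<and> r)
        - of_bool p - of_bool q - (of_bool r :: real)"
      if "\<not> (p \<and> q \<and> r)" "p \<Longrightarrow> t" "q \<Longrightarrow> t" "r \<Longrightarrow> t" for p q r t
      using that by (cases p; cases q; cases r) auto
    from this[OF not_all pair] show ?thesis
      unfolding c_def e_def R_def[symmetric] single by simp
  qed
  have "positive_semidefinite (H {0, 1, 2} + H {0} + H {1} + H {2}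
      - (H {0, 1} + H {0, 2} + H {1, 2}))"
  proof (rule positive_semidefinite_weighted_gram[where c = "\<lambda>f. c f / fact CARD('d)" and F = F])
    show "(H {0, 1, 2} + H {0} + H {1} + H {2} - (H {0, 1} + H {0, 2} + H {1, 2})) $ a $ b
      = (\<Sum>f\<in>F. of_real (c f / fact CARD('d)) * (D f a * cnj (D f b)))" for a b
      by (simp add: entry c_def add_divide_distrib diff_divide_distrib ring_distribs
          sum.distrib sum_subtractf)
  qed (simp add: c)
  then show ?thesis
    unfolding loewner_ge_def by (intro conjI hermitian_add herm) simp_all
qed

theorem corollary2p4:
  fixes A B C :: "('n::finite, 'm::finite) block_matrix"
  assumes "positive_semidefinite (flatten_blocks A)"
    and "positive_semidefinite (flatten_blocks B)"
    and "positive_semidefinite (flatten_blocks C)"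
  shows "det\<^sub>1 (A + B + C) + det\<^sub>1 A + det\<^sub>1 B + det\<^sub>1 C
           \<succeq>\<^sub>L det\<^sub>1 (A + B) + det\<^sub>1 (A + C) + det\<^sub>1 (B + C)
       \<and> det\<^sub>2 (A + B + C) + det\<^sub>2 A + det\<^sub>2 B + det\<^sub>2 C
           \<succeq>\<^sub>L det\<^sub>2 (A + B) + det\<^sub>2 (A + C) + det\<^sub>2 (B + C)"
proof -
  have gram: "\<exists>w. \<forall>i j r s. X $ i $ j $ r $ s = (\<Sum>p\<in>(UNIV :: ('m \<times> 'n) set). w p (i, r) * cnj (w p (j, s)))"
    if X: "positive_semidefinite (flatten_blocks X)" for X :: "('n, 'm) block_matrix"
  proof -
    obtain w :: "'m \<times> 'n \<Rightarrow> 'm \<times> 'n \<Rightarrow> complex"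
      where w: "\<And>x y. flatten_blocks X $ x $ y = (\<Sum>p\<in>UNIV. w p x * cnj (w p y))"
      using positive_semidefinite_gram[OF X] by metis
    have "X $ i $ j $ r $ s = (\<Sum>p\<in>UNIV. w p (i, r) * cnj (w p (j, s)))" for i j r s
      using w[of "(i, r)" "(j, s)"] by (simp add: flatten_blocks_def)
    then show ?thesis by blast
  qed
  obtain u :: "'m \<times> 'n \<Rightarrow> 'm \<times> 'n \<Rightarrow> complex" where
    A: "\<And>i j r s. A $ i $ j $ r $ s = (\<Sum>p\<in>UNIV. u p (i, r) * cnj (u p (j, s)))"
    using gram[OF assms(1)] by blast
  obtain v :: "'m \<times> 'n \<Rightarrow> 'm \<times> 'n \<Rightarrow> complex" where
    B: "\<And>i j r s. B $ i $ j $ r $ s = (\<Sum>p\<in>UNIV. v p (i, r) * cnj (v p (j, s)))"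
    using gram[OF assms(2)] by blast
  obtain w :: "'m \<times> 'n \<Rightarrow> 'm \<times> 'n \<Rightarrow> complex" where
    C: "\<And>i j r s. C $ i $ j $ r $ s = (\<Sum>p\<in>UNIV. w p (i, r) * cnj (w p (j, s)))"
    using gram[OF assms(3)] by blast
  \<comment> \<open>The labels 0, 1, 2 stand for \<open>A\<close>, \<open>B\<close>,
    \<open>C\<close>.\<close>
  define W where "W c = (if c = 0 then u else if c = 1 then v else w)" for c :: nat
  \<comment> \<open>The two partial determinants differ only in whether positions inside a block or
    block positions index the result. The same Gram vectors therefore serve both, with the pair
    \<open>(i, r)\<close> read in either order.\<close>
  have 1: "det\<^sub>1 X = det_block (\<lambda>a b i j. X $ i $ j $ a $ b)"
    and 2: "det\<^sub>2 X = det_block (\<lambda>i j r s. X $ i $ j $ r $ s)"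
    for X :: "('n, 'm) block_matrix"
    by (simp_all add: det\<^sub>1_def det\<^sub>2_def det_block_def)
  show ?thesis
    unfolding 1 2
    using det_block_hlawka[of "\<lambda>c k a i. W c k (i, a)"] det_block_hlawka[of "\<lambda>c k i r. W c k (i, r)"]
    by (simp add: W_def add.assoc flip: A B C vector_add_component)
qed

end
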